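(* Let $X$ be a nonzero reflexive Banach space and let $K$ be an infinite compact Hausdorff space. Suppose that $\mathcal{L}(X,C(K))$ is a dual space, i.e. there is a Banach space $Z$ with $Z^*$ isometrically isomorphic to $\mathcal{L}(X,C(K))$. Then the closed unit ball of $\mathcal{L}(X,C(K)) = Z^*$ has no points of $w^*$-$w$ continuity. In particular, the predual $Z$ has no very smooth points.
   Context: $\mathcal{L}(X,C(K))$ is the space of bounded linear operators from $X$ to $C(K)$ with the operator norm. For a Banach space $Z$, an element $z^*$ of the closed unit ball $Z^*_1$ of $Z^*$ is a point of $w^*$-$w$ continuity if the identity map $(Z^*_1, w^* ) \to (Z^*_1, \text{weak})$ is continuous at $z^*$, where $w^* = \sigma(Z^*,Z)$. A unit vector $z$ of a Banach space $Z$ is a smooth point of $Z$ if there is exactly one $z^* \in Z^*$ with $\|z^*\| = 1 = z^*(z)$. A unit vector $z \in Z$ is a very smooth point of $Z$ if, regarded as an element of $Z^{**}$ under the canonical embedding, it is a smooth point of $Z^{**}$. *)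

theory Defs
  imports "HOL-Analysis.Analysis"
begin

text \<open>Banach spaces are real. The dual of \<open>'a\<close> is \<open>'a \<Rightarrow>\<^sub>L real\<close> with the operator norm, and for
  compact \<open>'k\<close> the space \<open>'k \<Rightarrow>\<^sub>C real\<close> of bounded continuous functions with the supremum norm is \<open>C(K)\<close>.\<close>

text \<open>\<open>blinfun.prod_left x\<close> is the bounded operator \<open>f \<mapsto> f x\<close>.\<close>

definition canonical_embedding :: "'a::real_normed_vector \<Rightarrow> (('a \<Rightarrow>\<^sub>L real) \<Rightarrow>\<^sub>L real)"
  where "canonical_embedding x = blinfun.prod_left x"

definition reflexive_space :: "'a::real_normed_vector itself \<Rightarrow> bool"
  where "reflexive_space _ \<longleftrightarrow>
    surj (canonical_embedding :: 'a \<Rightarrow> (('a \<Rightarrow>\<^sub>L real) \<Rightarrow>\<^sub>L real))"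

definition isometric_isomorphism :: "('a::real_normed_vector \<Rightarrow> 'b::real_normed_vector) \<Rightarrow> bool"
  where "isometric_isomorphism T \<longleftrightarrow> linear T \<and> (\<forall>x. norm (T x) = norm x) \<and> surj T"

text \<open>Both topologies are initial topologies for evaluation maps: \<open>euclidean\<close> on a function space is
  the product topology. In particular the weak-star topology on the dual is the topology of pointwise
  convergence, that is, the strong operator topology on functionals.\<close>

definition weak_star_topology :: "('a::real_normed_vector \<Rightarrow>\<^sub>L real) topology"
  where "weak_star_topology = strong_operator_topology"

definition weak_topology :: "'a::real_normed_vector topology"
  where "weak_topology = pullback_topology UNIV (\<lambda>x (f :: 'a \<Rightarrow>\<^sub>L real). blinfun_apply f x) euclidean"

definition weak_star_weak_continuity_point :: "('a::real_normed_vector \<Rightarrow>\<^sub>L real) \<Rightarrow> bool"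
  where "weak_star_weak_continuity_point f \<longleftrightarrow> f \<in> cball 0 1 \<and>
    topcontinuous_at (subtopology weak_star_topology (cball 0 1))
      (subtopology weak_topology (cball 0 1)) (\<lambda>g. g) f"

definition smooth_point :: "'a::real_normed_vector \<Rightarrow> bool"
  where "smooth_point x \<longleftrightarrow> norm x = 1 \<and>
    (\<exists>!f :: 'a \<Rightarrow>\<^sub>L real. norm f = 1 \<and> blinfun_apply f x = 1)"

definition very_smooth_point :: "'a::real_normed_vector \<Rightarrow> bool"
  where "very_smooth_point x \<longleftrightarrow> norm x = 1 \<and> smooth_point (canonical_embedding x)"

end

theory Submission
  imports Defs
begin

text \<open>Suppose that \<open>f\<close> in the unit ball of the dual of \<open>Z\<close> were a point of weak-star to weak continuity, and
  read it through \<open>T\<close> as an operator \<open>A = T f\<close> from \<open>X\<close> to \<open>C(K)\<close>. The contradiction comes from moving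
  \<open>A\<close> towards another contraction \<open>B\<close> on larger and larger parts of \<open>K\<close>: if \<open>s \<in> C(K)\<close> has values in
  \<open>[0, 1]\<close>, then \<open>A + s (B - A)\<close> is at every point of \<open>K\<close> a convex combination of \<open>A\<close> and \<open>B\<close>, so it
  stays in the unit ball (\<open>norm_operator_interpolation_le\<close>).

  Since \<open>K\<close> is infinite, there are an increasing sequence \<open>s\<^sub>n\<close> of such functions and points \<open>k\<^sub>m\<close> with
  \<open>s\<^sub>n(k\<^sub>m) = 1\<close> for \<open>m < n\<close> and \<open>s\<^sub>n(k\<^sub>m) = 0\<close> for \<open>m \<ge> n\<close> (\<open>exists_increasing_functions\<close>). Let \<open>l\<close> be a
  cluster point of the \<open>k\<^sub>m\<close>; then \<open>s\<^sub>n(l) = 0\<close> for all \<open>n\<close>. Let \<open>b\<^sub>n\<close> be the functional that corresponds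
  to \<open>s\<^sub>n (B - A)\<close>, and let \<open>a\<close> be a weak-star cluster point of the bounded sequence \<open>b\<^sub>n\<close>, which exists by
  the Banach--Alaoglu theorem (\<open>bounded_imp_weak_star_cluster_point\<close>). For \<open>m \<ge> n\<close> the functional
  \<open>f + b\<^sub>m - b\<^sub>n\<close> lies in the unit ball, because \<open>s\<^sub>m - s\<^sub>n\<close> has values in \<open>[0, 1]\<close>; the ball is weak-star
  closed, so \<open>f + a - b\<^sub>n\<close> lies in it too. These functionals cluster weak-star at \<open>f\<close>, hence by the choice
  of \<open>f\<close> every element of the bidual that is eventually constant along \<open>b\<^sub>n\<close> has that constant as its value
  at \<open>a\<close> (\<open>continuity_point_cluster_eq\<close>). Evaluations of operators at \<open>x \<in> X\<close> and a point of \<open>K\<close> are such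
  elements. At \<open>k\<^sub>m\<close> they show that the continuous functions \<open>(T a) x\<close> and \<open>(B - A) x\<close> agree at every
  \<open>k\<^sub>m\<close>, hence at \<open>l\<close>; at \<open>l\<close> they show that \<open>(T a) x\<close> vanishes there. So \<open>B x\<close> and \<open>A x\<close> agree at \<open>l\<close>,
  whatever the contraction \<open>B\<close> is. But a suitable \<open>x\<close> separates two contractions at \<open>l\<close>: zero and an operator
  of rank one into the constants, which the Hahn--Banach theorem provides
  (\<open>exists_operator_value_neq\<close>).

  A very smooth point of \<open>Z\<close> would produce a continuity point
  (\<open>very_smooth_point_imp_continuity_point\<close>): the unique functional \<open>\<Phi>\<close> on the bidual that supports it restricts
  to some \<open>f\<close> in the dual of \<open>Z\<close>, and weak-star compactness of the unit ball of the third dual forces every net in the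
  ball of the dual of \<open>Z\<close> that converges weak-star to \<open>f\<close> to converge weakly.\<close>

section \<open>The Hahn--Banach theorem through minimal sublinear functionals\<close>

definition sublinear :: "('a::real_vector \<Rightarrow> real) \<Rightarrow> bool"
  where "sublinear p \<longleftrightarrow>
    (\<forall>x y. p (x + y) \<le> p x + p y) \<and> (\<forall>c>0. \<forall>x. p (c *\<^sub>R x) \<le> c * p x)"

lemma sublinear_add: "sublinear p \<Longrightarrow> p (x + y) \<le> p x + p y"
  by (simp add: sublinear_def)

lemma sublinear_scaleR:
  assumes "sublinear p" "c > 0"
  shows "p (c *\<^sub>R x) = c * p x"
proof (rule antisym)
  show "p (c *\<^sub>R x) \<le> c * p x"
    using assms by (simp add: sublinear_def)
  have "p (inverse c *\<^sub>R (c *\<^sub>R x)) \<le> inverse c * p (c *\<^sub>R x)"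
    using assms unfolding sublinear_def by (meson positive_imp_inverse_positive)
  with \<open>c > 0\<close> show "c * p x \<le> p (c *\<^sub>R x)"
    by (simp add: field_simps)
qed

lemma sublinear_zero: "sublinear p \<Longrightarrow> p 0 = 0"
  using sublinear_scaleR[of p 2 0] by simp

lemma sublinear_ge_minus: "sublinear p \<Longrightarrow> - p (- x) \<le> p x"
  using sublinear_add[of p x "- x"] sublinear_zero[of p] by simp

text \<open>For sublinear \<open>p\<close> this is the largest sublinear functional \<open>q \<le> p\<close> with \<open>q (- y) \<le> - p y\<close>. A minimal \<open>p\<close> has to
  coincide with it, which is what makes minimal sublinear functionals odd; for the norm,
  every linear functional below it takes the value \<open>norm y\<close> at \<open>y\<close>.\<close>
definition directional_infimum :: "('a::real_vector \<Rightarrow> real) \<Rightarrow> 'a \<Rightarrow> 'a \<Rightarrow> real"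
  where "directional_infimum p y x = (INF t\<in>{0..}. p (x + t *\<^sub>R y) - t * p y)"

lemma directional_infimum_le:
  assumes "sublinear p" "t \<ge> 0"
  shows "directional_infimum p y x \<le> p (x + t *\<^sub>R y) - t * p y"
  unfolding directional_infimum_def
proof (rule cINF_lower)
  have "- p (- x) \<le> p (x + t *\<^sub>R y) - t * p y" if "t \<ge> 0" for t
  proof -
    have "t * p y = p (t *\<^sub>R y)"
      using sublinear_scaleR[OF assms(1), of t y] sublinear_zero[OF assms(1)] that
      by (cases "t = 0") auto
    also have "\<dots> \<le> p (x + t *\<^sub>R y) + p (- x)"
      using sublinear_add[OF assms(1), of "x + t *\<^sub>R y" "- x"] by simp
    finally show ?thesis by simp
  qed
  then show "bdd_below ((\<lambda>t. p (x + t *\<^sub>R y) - t * p y) ` {0..})"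
    by (intro bdd_belowI2[of _ "- p (- x)"]) auto
qed (use assms in auto)

lemma le_directional_infimum:
  assumes "\<And>t. t \<ge> 0 \<Longrightarrow> c \<le> p (x + t *\<^sub>R y) - t * p y"
  shows "c \<le> directional_infimum p y x"
  unfolding directional_infimum_def by (rule cINF_greatest) (use assms in auto)

lemma sublinear_directional_infimum:
  assumes "sublinear p"
  shows "sublinear (directional_infimum p y)"
proof -
  let ?q = "directional_infimum p y"
  have "?q (a + b) \<le> ?q a + ?q b" for a b
  proof -
    have 1: "?q (a + b) \<le> (p (a + s *\<^sub>R y) - s * p y) + (p (b + t *\<^sub>R y) - t * p y)"
      if "s \<ge> 0" "t \<ge> 0" for s t
    proof -
      have "?q (a + b) \<le> p ((a + b) + (s + t) *\<^sub>R y) - (s + t) * p y"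
        by (rule directional_infimum_le) (use assms that in auto)
      also have "p ((a + b) + (s + t) *\<^sub>R y) \<le> p (a + s *\<^sub>R y) + p (b + t *\<^sub>R y)"
        using sublinear_add[OF assms, of "a + s *\<^sub>R y" "b + t *\<^sub>R y"] by (simp add: algebra_simps)
      finally show ?thesis by (simp add: algebra_simps)
    qed
    have "?q (a + b) - (p (b + t *\<^sub>R y) - t * p y) \<le> ?q a" if "t \<ge> 0" for t
      using 1[OF _ that] by (intro le_directional_infimum) (simp add: algebra_simps)
    then have "?q (a + b) - ?q a \<le> ?q b"
      by (intro le_directional_infimum) (simp add: algebra_simps)
    then show ?thesis by simp
  qed
  moreover have "?q (c *\<^sub>R x) \<le> c * ?q x" if "c > 0" for c x
  proof -
    have "?q (c *\<^sub>R x) / c \<le> p (x + t *\<^sub>R y) - t * p y" if "t \<ge> 0" for t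
    proof -
      have "?q (c *\<^sub>R x) \<le> p (c *\<^sub>R x + (c * t) *\<^sub>R y) - (c * t) * p y"
        by (rule directional_infimum_le) (use assms \<open>c > 0\<close> that in auto)
      also have "p (c *\<^sub>R x + (c * t) *\<^sub>R y) = c * p (x + t *\<^sub>R y)"
        using sublinear_scaleR[OF assms \<open>c > 0\<close>, of "x + t *\<^sub>R y"] by (simp add: algebra_simps)
      finally show ?thesis using \<open>c > 0\<close> by (simp add: field_simps)
    qed
    then have "?q (c *\<^sub>R x) / c \<le> ?q x"
      by (rule le_directional_infimum)
    then show ?thesis using \<open>c > 0\<close> by (simp add: field_simps)
  qed
  ultimately show ?thesis by (simp add: sublinear_def)
qed

text \<open>Zorn's lemma for the pointwise order. The pointwise infimum of a nonempty chain is finite because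
  \<open>- q (- x) \<le> - p (- x) \<le> p x\<close> for every sublinear \<open>p \<le> q\<close>.\<close>
lemma exists_minimal_sublinear:
  assumes q: "sublinear q"
  obtains p where "sublinear p" "\<And>x. p x \<le> q x"
    "\<And>r. sublinear r \<Longrightarrow> (\<And>x. r x \<le> p x) \<Longrightarrow> r = p"
proof -
  define A where "A = {p. sublinear p \<and> (\<forall>x. p x \<le> q x)}"
  define P where "P = (\<lambda>(p::'a \<Rightarrow> real) r. \<forall>x. r x \<le> p x)"
  have "\<exists>m\<in>A. \<forall>a\<in>A. P m a \<longrightarrow> a = m"
  proof (rule predicate_Zorn)
    show "partial_order_on A (relation_of P A)"
      by (rule partial_order_on_relation_ofI) (auto simp: P_def fun_eq_iff intro: order_trans antisym)
  next
    fix C assume C: "C \<in> Chains (relation_of P A)"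
    then have CA: "C \<subseteq> A" and total: "\<And>a b. a \<in> C \<Longrightarrow> b \<in> C \<Longrightarrow> P a b \<or> P b a"
      by (auto simp: Chains_def relation_of_def)
    show "\<exists>u\<in>A. \<forall>a\<in>C. P a u"
    proof (cases "C = {}")
      case True
      with q show ?thesis by (auto simp: A_def)
    next
      case False
      define u where "u = (\<lambda>x. INF p\<in>C. p x)"
      have bdd: "bdd_below ((\<lambda>p. p x) ` C)" for x
      proof (rule bdd_belowI2[of _ "- q (- x)"])
        fix p assume "p \<in> C"
        then have "sublinear p" "p (- x) \<le> q (- x)" using CA by (auto simp: A_def)
        then show "- q (- x) \<le> p x" using sublinear_ge_minus[of p x] by simp
      qed
      have lower: "u x \<le> p x" if "p \<in> C" for p x
        unfolding u_def by (rule cINF_lower[OF bdd that])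
      have greatest: "c \<le> u x" if "\<And>p. p \<in> C \<Longrightarrow> c \<le> p x" for c x
        unfolding u_def by (rule cINF_greatest[OF False that])
      have "u (x + y) \<le> u x + u y" for x y
      proof -
        \<comment> \<open>Of two members of the chain, the smaller one bounds the infimum at \<open>x + y\<close>.\<close>
        have 1: "u (x + y) \<le> a x + b y" if "a \<in> C" "b \<in> C" for a b
        proof -
          have sub: "sublinear a" "sublinear b" using that CA by (auto simp: A_def)
          have "u (x + y) \<le> a x + a y" "u (x + y) \<le> b x + b y"
            using lower[OF that(1), of "x + y"] lower[OF that(2), of "x + y"]
              sublinear_add[OF sub(1), of x y] sublinear_add[OF sub(2), of x y] by simp_all
          moreover have "b x \<le> a x \<or> a y \<le> b y"
            using total[OF that] by (auto simp: P_def)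
          ultimately show ?thesis by linarith
        qed
        have "u (x + y) - b y \<le> u x" if "b \<in> C" for b
          using 1[OF _ that] by (intro greatest) (simp add: algebra_simps)
        then have "u (x + y) - u x \<le> u y"
          by (intro greatest) (simp add: algebra_simps)
        then show ?thesis by simp
      qed
      moreover have "u (c *\<^sub>R x) \<le> c * u x" if "c > 0" for c x
      proof -
        have "u (c *\<^sub>R x) / c \<le> p x" if "p \<in> C" for p
          using lower[OF that, of "c *\<^sub>R x"] sublinear_scaleR[of p c x] \<open>c > 0\<close> that CA
          by (auto simp: A_def field_simps)
        then have "u (c *\<^sub>R x) / c \<le> u x" by (rule greatest)
        then show ?thesis using \<open>c > 0\<close> by (simp add: field_simps)
      qed
      moreover have "u x \<le> q x" for x
      proof -
        obtain p where "p \<in> C" using False by blast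
        then have "u x \<le> p x" "p x \<le> q x" using lower CA by (auto simp: A_def)
        then show ?thesis by simp
      qed
      ultimately have "u \<in> A" by (simp add: A_def sublinear_def)
      with lower show ?thesis by (auto simp: P_def)
    qed
  qed
  then obtain m where m: "m \<in> A" "\<And>a. a \<in> A \<Longrightarrow> P m a \<Longrightarrow> a = m" by blast
  show thesis
  proof (rule that)
    show "sublinear m" "\<And>x. m x \<le> q x" using m(1) by (auto simp: A_def)
    fix r assume r: "sublinear r" "\<And>x. r x \<le> m x"
    have "r x \<le> q x" for x
      using r(2)[of x] m(1) unfolding A_def by (force intro: order_trans)
    with r show "r = m" by (intro m(2)) (auto simp: A_def P_def)
  qed
qed

text \<open>Minimality applied to \<open>directional_infimum p y\<close> gives \<open>p (- y) \<le> - p y\<close>, and a sublinear odd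
  functional is also superadditive.\<close>
lemma minimal_sublinear_linear:
  assumes p: "sublinear p" and min: "\<And>r. sublinear r \<Longrightarrow> (\<And>x. r x \<le> p x) \<Longrightarrow> r = p"
  shows "linear p"
proof -
  have minus: "p (- y) = - p y" for y
  proof (rule antisym)
    have "directional_infimum p y = p"
      using directional_infimum_le[OF p, of 0]
      by (intro min sublinear_directional_infimum p) simp
    then show "p (- y) \<le> - p y"
      using directional_infimum_le[OF p, of 1 y "- y"] sublinear_zero[OF p] by simp
    show "- p y \<le> p (- y)"
      using sublinear_ge_minus[OF p, of "- y"] by simp
  qed
  show ?thesis
  proof (rule linearI)
    fix x y
    show "p (x + y) = p x + p y"
      using sublinear_add[OF p, of x y] sublinear_add[OF p, of "- x" "- y"] minus[of "x + y"]
        minus[of x] minus[of y] by simp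
  next
    fix c x
    show "p (c *\<^sub>R x) = c *\<^sub>R p x"
    proof (cases c "0::real" rule: linorder_cases)
      case less
      then show ?thesis
        using sublinear_scaleR[OF p, of "- c" x] minus[of "c *\<^sub>R x"] by simp
    next
      case equal
      then show ?thesis using sublinear_zero[OF p] by simp
    next
      case greater
      then show ?thesis using sublinear_scaleR[OF p] by simp
    qed
  qed
qed

text \<open>Any linear functional \<open>p\<close> below \<open>directional_infimum norm x0\<close> is below the norm and satisfies
  \<open>p (- x0) \<le> - norm x0\<close>.\<close>
theorem exists_norming_functional:
  fixes x0 :: "'a::real_normed_vector"
  obtains f :: "'a \<Rightarrow>\<^sub>L real" where "norm f \<le> 1" "f x0 = norm x0"
proof -
  have norm: "sublinear (norm :: 'a \<Rightarrow> real)"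
    by (auto simp: sublinear_def norm_triangle_ineq)
  obtain p where p: "sublinear p" "\<And>x. p x \<le> directional_infimum norm x0 x"
    and min: "\<And>r. sublinear r \<Longrightarrow> (\<And>x. r x \<le> p x) \<Longrightarrow> r = p"
    using exists_minimal_sublinear[OF sublinear_directional_infimum[OF norm]] by blast
  have lin: "linear p" by (rule minimal_sublinear_linear[OF p(1) min])
  have le: "p x \<le> norm x" for x
    using p(2)[of x] directional_infimum_le[OF norm, of 0 x0 x] by simp
  have abs_le: "\<bar>p x\<bar> \<le> norm x" for x
    using le[of x] le[of "- x"] linear_neg[OF lin, of x] by simp
  have "p (- x0) \<le> - norm x0"
    using p(2)[of "- x0"] directional_infimum_le[OF norm, of 1 x0 "- x0"] by simp
  then have eq: "p x0 = norm x0"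
    using le[of x0] linear_neg[OF lin, of x0] by simp
  have bl: "bounded_linear p"
    using lin abs_le by (intro bounded_linear_intro[where K = 1]) (auto simp: linear_add linear_scale)
  show thesis
  proof (rule that[of "Blinfun p"])
    show "norm (Blinfun p) \<le> 1"
      by (rule norm_blinfun_bound) (use abs_le in \<open>auto simp: bounded_linear_Blinfun_apply[OF bl]\<close>)
    show "Blinfun p x0 = norm x0" by (simp add: bounded_linear_Blinfun_apply[OF bl] eq)
  qed
qed

section \<open>Cluster points in the weak-star topology\<close>

lemma compact_imp_cluster_point:
  assumes "compact S" "F \<noteq> bot" "eventually (\<lambda>i. x i \<in> S) F"
  obtains a where "a \<in> S" "\<And>U. open U \<Longrightarrow> a \<in> U \<Longrightarrow> frequently (\<lambda>i. x i \<in> U) F"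
proof -
  obtain a where a: "a \<in> S" "inf (nhds a) (filtermap x F) \<noteq> bot"
    using assms(1)[unfolded compact_filter, rule_format, of "filtermap x F"] assms(2,3)
    by (auto simp: filtermap_bot_iff eventually_filtermap)
  show thesis
  proof (rule that[OF a(1)])
    fix U assume U: "open U" "a \<in> U"
    show "frequently (\<lambda>i. x i \<in> U) F"
    proof (rule ccontr)
      assume "\<not> ?thesis"
      then have "eventually (\<lambda>y. y \<notin> U) (filtermap x F)"
        by (simp add: not_frequently eventually_filtermap)
      moreover have "eventually (\<lambda>y. y \<in> U) (nhds a)"
        using U by (rule eventually_nhds_in_open)
      ultimately have "eventually (\<lambda>y. False) (inf (nhds a) (filtermap x F))"
        unfolding eventually_inf by fastforce
      with a(2) show False by simp
    qed
  qed
qed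

lemma openin_weak_star_iff:
  "openin weak_star_topology U \<longleftrightarrow> (\<exists>V. open V \<and> U = {f. blinfun_apply f \<in> V})"
  by (auto simp: weak_star_topology_def strong_operator_topology_def openin_pullback_topology)

lemma openin_weak_iff:
  "openin weak_topology U \<longleftrightarrow>
    (\<exists>V. open V \<and> U = {x. (\<lambda>f::'a::real_normed_vector \<Rightarrow>\<^sub>L real. blinfun_apply f x) \<in> V})"
  by (auto simp: weak_topology_def openin_pullback_topology)

lemma open_coordinate:
  assumes "open S"
  shows "open {g :: 'i \<Rightarrow> 'b::topological_space. g x \<in> S}"
  using open_vimage[OF assms continuous_on_product_coordinates] by (simp add: vimage_def)

lemma openin_weak_star_evaluation:
  "open S \<Longrightarrow> openin weak_star_topology {f. blinfun_apply f x \<in> S}"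
  unfolding openin_weak_star_iff by (rule exI[of _ "{g. g x \<in> S}"]) (simp add: open_coordinate)

lemma openin_weak_evaluation:
  fixes f :: "'a::real_normed_vector \<Rightarrow>\<^sub>L real"
  shows "open S \<Longrightarrow> openin weak_topology {x. blinfun_apply f x \<in> S}"
  unfolding openin_weak_iff
  by (rule exI[of _ "{g. g f \<in> S}"]) (simp add: open_coordinate)

lemma openin_weak_star_reflection:
  assumes "openin weak_star_topology U"
  shows "openin weak_star_topology {f. a - f \<in> U}"
proof -
  obtain V where V: "open V" "U = {f. blinfun_apply f \<in> V}"
    using assms by (auto simp: openin_weak_star_iff)
  have "continuous_on UNIV (\<lambda>(g::'a \<Rightarrow> real) x. blinfun_apply a x - g x)"
    by (intro continuous_on_coordinatewise_then_product continuous_intros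
        continuous_on_product_coordinates)
  then have "open ((\<lambda>g x. blinfun_apply a x - g x) -` V)"
    using V(1) by (intro open_vimage) auto
  moreover have "{f. a - f \<in> U} = {f. blinfun_apply f \<in> (\<lambda>g x. blinfun_apply a x - g x) -` V}"
    by (auto simp: V(2) minus_blinfun.rep_eq)
  ultimately show ?thesis unfolding openin_weak_star_iff by blast
qed

definition weak_star_cluster_point ::
    "('a::real_normed_vector \<Rightarrow>\<^sub>L real) \<Rightarrow> ('i \<Rightarrow> 'a \<Rightarrow>\<^sub>L real) \<Rightarrow> 'i filter \<Rightarrow> bool"
  where "weak_star_cluster_point a b F \<longleftrightarrow>
    (\<forall>U. openin weak_star_topology U \<and> a \<in> U \<longrightarrow> frequently (\<lambda>i. b i \<in> U) F)"

lemma weak_star_cluster_point_evaluation: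
  assumes "weak_star_cluster_point a b F" "\<epsilon> > 0"
  shows "frequently (\<lambda>i. \<bar>blinfun_apply (b i) x - blinfun_apply a x\<bar> < \<epsilon>) F"
proof -
  have "openin weak_star_topology {g. blinfun_apply g x \<in> ball (blinfun_apply a x) \<epsilon>}"
    by (rule openin_weak_star_evaluation) simp
  with assms have "frequently (\<lambda>i. b i \<in> {g. blinfun_apply g x \<in> ball (blinfun_apply a x) \<epsilon>}) F"
    unfolding weak_star_cluster_point_def by force
  then show ?thesis by (simp add: dist_real_def abs_minus_commute)
qed

text \<open>The Banach--Alaoglu theorem, for families along a filter. The coordinates of the family stay in compact
  intervals, so Tychonoff's theorem gives a cluster point among all real functions on the space, and it remains
  to see that this function is linear.\<close>
theorem bounded_imp_weak_star_cluster_point: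
  fixes b :: "'i \<Rightarrow> 'a::real_normed_vector \<Rightarrow>\<^sub>L real"
  assumes F: "F \<noteq> bot" and bound: "eventually (\<lambda>i. norm (b i) \<le> C) F"
  obtains a where "norm a \<le> C" "weak_star_cluster_point a b F"
proof -
  define S where "S = (\<Pi>\<^sub>E x\<in>(UNIV::'a set). cball (0::real) (C * norm x))"
  have "compactin (product_topology (\<lambda>i. euclidean) UNIV) S"
    unfolding S_def compactin_PiE by simp
  then have "compact S" by (simp add: euclidean_product_topology)
  moreover have "eventually (\<lambda>i. blinfun_apply (b i) \<in> S) F"
    using bound
  proof eventually_elim
    case (elim i)
    have "\<bar>blinfun_apply (b i) x\<bar> \<le> C * norm x" for x
      using norm_blinfun[of "b i" x] mult_right_mono[OF elim, of "norm x"] by simp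
    then show ?case by (auto simp: S_def)
  qed
  ultimately obtain g where g: "g \<in> S"
    "\<And>U. open U \<Longrightarrow> g \<in> U \<Longrightarrow> frequently (\<lambda>i. blinfun_apply (b i) \<in> U) F"
    by (rule compact_imp_cluster_point[OF _ F]) (rule that)
  obtain i where "norm (b i) \<le> C"
    using eventually_happens'[OF F bound] by blast
  then have "C \<ge> 0"
    using norm_ge_zero[of "b i"] by linarith
  have gC: "\<bar>g x\<bar> \<le> C * norm x" for x using g(1) by (auto simp: S_def)
  \<comment> \<open>A linear identity is a closed condition on three coordinates, so it passes to the cluster point.\<close>
  have combination: "g (r *\<^sub>R x + s *\<^sub>R y) = r * g x + s * g y" for r s x y
  proof (rule ccontr)
    let ?U = "{h :: 'a \<Rightarrow> real. h (r *\<^sub>R x + s *\<^sub>R y) - r * h x - s * h y \<noteq> 0}"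
    assume "g (r *\<^sub>R x + s *\<^sub>R y) \<noteq> r * g x + s * g y"
    moreover have "open ?U"
      by (intro open_Collect_neq continuous_intros continuous_on_product_coordinates)
    ultimately have "frequently (\<lambda>i. blinfun_apply (b i) \<in> ?U) F"
      by (intro g(2)) auto
    then show False by (simp add: blinfun.add_right blinfun.scaleR_right)
  qed
  have bl: "bounded_linear g"
  proof (rule bounded_linear_intro[where K = C])
    show "g (x + y) = g x + g y" for x y using combination[of 1 x 1 y] by simp
    show "g (r *\<^sub>R x) = r *\<^sub>R g x" for r x using combination[of r x 0 0] by simp
    show "norm (g x) \<le> norm x * C" for x using gC[of x] by (simp add: mult.commute)
  qed
  show thesis
  proof (rule that)
    show "norm (Blinfun g) \<le> C"
      by (rule norm_blinfun_bound) (use gC \<open>C \<ge> 0\<close> in \<open>auto simp: bounded_linear_Blinfun_apply[OF bl]\<close>)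
    show "weak_star_cluster_point (Blinfun g) b F"
      unfolding weak_star_cluster_point_def openin_weak_star_iff
      using g(2) by (auto simp: bounded_linear_Blinfun_apply[OF bl])
  qed
qed

section \<open>Points of weak-star to weak continuity\<close>

text \<open>The subspace topologies of the ball are traded for topologies of the whole space.\<close>
lemma weak_star_weak_continuity_point_iff:
  "weak_star_weak_continuity_point f \<longleftrightarrow> norm f \<le> 1 \<and>
    (\<forall>W. openin weak_topology W \<and> f \<in> W \<longrightarrow>
      (\<exists>U. openin weak_star_topology U \<and> f \<in> U \<and> U \<inter> cball 0 1 \<subseteq> W))"
proof -
  have [simp]: "topspace weak_topology = UNIV" "topspace weak_star_topology = UNIV"
    by (auto simp: weak_topology_def weak_star_topology_def topspace_pullback_topology
        strong_operator_topology_topspace)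
  show ?thesis
  proof
    assume *: "weak_star_weak_continuity_point f"
    have "\<exists>U. openin weak_star_topology U \<and> f \<in> U \<and> U \<inter> cball 0 1 \<subseteq> W"
      if W: "openin weak_topology W" "f \<in> W" for W
    proof -
      have "openin (subtopology weak_topology (cball 0 1)) (W \<inter> cball 0 1)"
        using W by (auto simp: openin_subtopology)
      then obtain U where "openin (subtopology weak_star_topology (cball 0 1)) U" "f \<in> U"
        "\<forall>y\<in>U. y \<in> W \<inter> cball 0 1"
        using * W unfolding weak_star_weak_continuity_point_def topcontinuous_at_def by blast
      then show ?thesis by (auto simp: openin_subtopology)
    qed
    with * show "norm f \<le> 1 \<and> (\<forall>W. openin weak_topology W \<and> f \<in> W \<longrightarrow>
      (\<exists>U. openin weak_star_topology U \<and> f \<in> U \<and> U \<inter> cball 0 1 \<subseteq> W))"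
      by (auto simp: weak_star_weak_continuity_point_def)
  next
    assume *: "norm f \<le> 1 \<and> (\<forall>W. openin weak_topology W \<and> f \<in> W \<longrightarrow>
      (\<exists>U. openin weak_star_topology U \<and> f \<in> U \<and> U \<inter> cball 0 1 \<subseteq> W))"
    show "weak_star_weak_continuity_point f"
      unfolding weak_star_weak_continuity_point_def topcontinuous_at_def
    proof (intro conjI allI impI)
      fix V assume "openin (subtopology weak_topology (cball 0 1)) V \<and> f \<in> V"
      then obtain W where W: "openin weak_topology W" "V = W \<inter> cball 0 1" "f \<in> W"
        by (auto simp: openin_subtopology)
      then obtain U where "openin weak_star_topology U" "f \<in> U" "U \<inter> cball 0 1 \<subseteq> W"
        using * by blast
      then show "\<exists>U. openin (subtopology weak_star_topology (cball 0 1)) U \<and> f \<in> U \<and> (\<forall>y\<in>U. y \<in> V)"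
        using * W(2) by (intro exI[of _ "U \<inter> cball 0 1"]) (auto simp: openin_subtopology)
    qed (use * in auto)
  qed
qed

text \<open>The family \<open>f + a - b i\<close> lives in the unit ball and clusters weak-star at \<open>f\<close>; at a continuity point it
  therefore clusters weakly there, which is a statement about \<open>b i\<close> and \<open>a\<close> alone.\<close>
lemma continuity_point_cluster:
  fixes \<psi> :: "('a::real_normed_vector \<Rightarrow>\<^sub>L real) \<Rightarrow>\<^sub>L real"
  assumes f: "weak_star_weak_continuity_point f"
    and cluster: "weak_star_cluster_point a b F"
    and near: "\<And>i. norm (f + a - b i) \<le> 1"
    and "(\<epsilon>::real) > 0"
  shows "frequently (\<lambda>i. \<bar>blinfun_apply \<psi> (b i) - blinfun_apply \<psi> a\<bar> < \<epsilon>) F"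
proof -
  let ?W = "{g. blinfun_apply \<psi> g \<in> ball (blinfun_apply \<psi> f) \<epsilon>}"
  have "openin weak_topology ?W" by (rule openin_weak_evaluation) simp
  moreover have "f \<in> ?W" using \<open>\<epsilon> > 0\<close> by simp
  ultimately obtain U where U: "openin weak_star_topology U" "f \<in> U" "U \<inter> cball 0 1 \<subseteq> ?W"
    using f unfolding weak_star_weak_continuity_point_iff by blast
  have "openin weak_star_topology {g. (f + a) - g \<in> U}" "a \<in> {g. (f + a) - g \<in> U}"
    using openin_weak_star_reflection[OF U(1)] U(2) by auto
  then have "frequently (\<lambda>i. (f + a) - b i \<in> U) F"
    using cluster unfolding weak_star_cluster_point_def by force
  then show ?thesis
  proof (rule frequently_elim1)
    fix i assume "(f + a) - b i \<in> U"
    with U(3) near[of i] have "(f + a) - b i \<in> ?W" by auto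
    then show "\<bar>blinfun_apply \<psi> (b i) - blinfun_apply \<psi> a\<bar> < \<epsilon>"
      by (simp add: dist_real_def blinfun.add_right blinfun.diff_right abs_minus_commute)
  qed
qed

lemma continuity_point_cluster_eq:
  fixes \<psi> :: "('a::real_normed_vector \<Rightarrow>\<^sub>L real) \<Rightarrow>\<^sub>L real"
  assumes f: "weak_star_weak_continuity_point f"
    and cluster: "weak_star_cluster_point a b F"
    and near: "\<And>i. norm (f + a - b i) \<le> 1"
    and const: "eventually (\<lambda>i. blinfun_apply \<psi> (b i) = c) F"
  shows "blinfun_apply \<psi> a = c"
proof (rule ccontr)
  assume "blinfun_apply \<psi> a \<noteq> c"
  then have "frequently (\<lambda>i. \<bar>blinfun_apply \<psi> (b i) - blinfun_apply \<psi> a\<bar> < \<bar>c - blinfun_apply \<psi> a\<bar>) F"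
    by (intro continuity_point_cluster[OF f cluster near]) auto
  from frequently_eventually_frequently[OF this const] show False
    by (auto dest: frequently_ex)
qed

lemma norm_canonical_embedding_le: "norm (canonical_embedding x) \<le> norm x"
proof (rule norm_blinfun_bound)
  fix f :: "'a \<Rightarrow>\<^sub>L real"
  show "norm (canonical_embedding x f) \<le> norm x * norm f"
    using norm_blinfun[of f x] by (simp add: canonical_embedding_def mult.commute)
qed simp

lemma canonical_embedding_apply [simp]: "blinfun_apply (canonical_embedding x) f = blinfun_apply f x"
  by (simp add: canonical_embedding_def)

lemma bounded_linear_canonical_embedding: "bounded_linear canonical_embedding"
  unfolding canonical_embedding_def by (rule blinfun.bounded_linear_prod_left)

text \<open>The continuity point is the restriction \<open>f\<close> of the supporting functional \<open>\<Phi>\<close> to the space itself; as the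
  canonical image of \<open>f\<close> supports the same point, it equals \<open>\<Phi>\<close>. If \<open>f\<close> were not a continuity point, some filter on
  the ball would converge weak-star to \<open>f\<close> and avoid a weak neighbourhood \<open>W\<close> of \<open>f\<close>. A weak-star cluster point \<open>\<Gamma>\<close>
  of its canonical image in the third dual again supports the point, so it is the image of \<open>f\<close>. But the weak
  topology is induced by the weak-star topology of the third dual, so the filter would have to meet \<open>W\<close>.\<close>
theorem very_smooth_point_imp_continuity_point:
  fixes z :: "'z::real_normed_vector"
  assumes "very_smooth_point z"
  shows "\<exists>f :: 'z \<Rightarrow>\<^sub>L real. weak_star_weak_continuity_point f"
proof -
  have "\<exists>!\<Phi> :: (('z \<Rightarrow>\<^sub>L real) \<Rightarrow>\<^sub>L real) \<Rightarrow>\<^sub>L real. norm \<Phi> = 1 \<and> blinfun_apply \<Phi> (canonical_embedding z) = 1"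
    and cz: "norm (canonical_embedding z) = 1"
    using assms by (auto simp: very_smooth_point_def smooth_point_def)
  then obtain \<Phi> :: "(('z \<Rightarrow>\<^sub>L real) \<Rightarrow>\<^sub>L real) \<Rightarrow>\<^sub>L real"
    where \<Phi>: "norm \<Phi> = 1" "\<Phi> (canonical_embedding z) = 1"
      and unique': "\<And>\<Psi> :: (('z \<Rightarrow>\<^sub>L real) \<Rightarrow>\<^sub>L real) \<Rightarrow>\<^sub>L real. norm \<Psi> = 1 \<Longrightarrow> blinfun_apply \<Psi> (canonical_embedding z) = 1 \<Longrightarrow> \<Psi> = \<Phi>" by blast
  have unique: "\<Psi> = \<Phi>" if "norm \<Psi> \<le> 1" "blinfun_apply \<Psi> (canonical_embedding z) = 1"
    for \<Psi> :: "(('z \<Rightarrow>\<^sub>L real) \<Rightarrow>\<^sub>L real) \<Rightarrow>\<^sub>L real"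
    using norm_blinfun[of \<Psi> "canonical_embedding z"] that cz by (intro unique') auto
  define f where "f = \<Phi> o\<^sub>L Blinfun canonical_embedding"
  have f_apply: "f w = \<Phi> (canonical_embedding w)" for w
    by (simp add: f_def bounded_linear_Blinfun_apply[OF bounded_linear_canonical_embedding])
  have f_norm: "norm f \<le> 1"
  proof (rule norm_blinfun_bound)
    fix w
    show "norm (f w) \<le> 1 * norm w"
      using norm_blinfun[of \<Phi> "canonical_embedding w"] norm_canonical_embedding_le[of w] \<Phi>(1)
      by (simp add: f_apply)
  qed simp
  have f_embed: "canonical_embedding f = \<Phi>"
    using norm_canonical_embedding_le[of f] f_norm \<Phi>(2) by (intro unique) (auto simp: f_apply)
  have "weak_star_weak_continuity_point f"
    unfolding weak_star_weak_continuity_point_iff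
  proof (intro conjI allI impI f_norm, elim conjE)
    fix W assume W: "openin weak_topology W" "f \<in> W"
    show "\<exists>U. openin weak_star_topology U \<and> f \<in> U \<and> U \<inter> cball 0 1 \<subseteq> W"
    proof (rule ccontr)
      assume no_nbhd: "\<not> ?thesis"
      define F where "F = inf (nhdsin weak_star_topology f) (principal (cball 0 1 - W))"
      have ev: "eventually Q F \<longleftrightarrow> (\<exists>U. openin weak_star_topology U \<and> f \<in> U \<and>
          (\<forall>g\<in>U. norm g \<le> 1 \<longrightarrow> g \<notin> W \<longrightarrow> Q g))" for Q
        by (auto simp: F_def eventually_inf_principal eventually_nhdsin weak_star_topology_def
            strong_operator_topology_topspace)
      have "F \<noteq> bot"
        using no_nbhd ev[of "\<lambda>_. False"] by (auto simp: trivial_limit_def)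
      moreover have "openin weak_star_topology (UNIV :: ('z \<Rightarrow>\<^sub>L real) set)"
        by (auto simp: openin_weak_star_iff)
      then have ev_outside: "eventually (\<lambda>g. norm g \<le> 1 \<and> g \<notin> W) F"
        unfolding ev by blast
      then have "eventually (\<lambda>g. norm (canonical_embedding g) \<le> 1) F"
        by eventually_elim (use norm_canonical_embedding_le order_trans in blast)
      ultimately obtain \<Gamma> where \<Gamma>: "norm \<Gamma> \<le> 1" "weak_star_cluster_point \<Gamma> canonical_embedding F"
        by (rule bounded_imp_weak_star_cluster_point)
      have "\<Gamma> (canonical_embedding z) = 1"
      proof (rule ccontr)
        assume neq: "\<Gamma> (canonical_embedding z) \<noteq> 1"
        define \<epsilon> where "\<epsilon> = \<bar>\<Gamma> (canonical_embedding z) - 1\<bar> / 2"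
        have "\<epsilon> > 0" using neq by (simp add: \<epsilon>_def)
        have "openin weak_star_topology {g. blinfun_apply g z \<in> ball (1::real) \<epsilon>}"
          by (rule openin_weak_star_evaluation) simp
        then have "eventually (\<lambda>g. \<bar>blinfun_apply g z - 1\<bar> < \<epsilon>) F"
          using \<open>\<epsilon> > 0\<close> \<Phi>(2) unfolding ev
          by (intro exI[of _ "{g. blinfun_apply g z \<in> ball (1::real) \<epsilon>}"])
            (auto simp: f_apply dist_real_def)
        from frequently_eventually_frequently[OF
            weak_star_cluster_point_evaluation[OF \<Gamma>(2) \<open>\<epsilon> > 0\<close>, of "canonical_embedding z"] this]
        obtain g where "\<bar>blinfun_apply g z - 1\<bar> < \<epsilon>"
          "\<bar>blinfun_apply g z - \<Gamma> (canonical_embedding z)\<bar> < \<epsilon>"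
          by (auto dest: frequently_ex)
        then show False by (simp add: \<epsilon>_def abs_if split: if_splits)
      qed
      with \<Gamma>(1) have \<Gamma>_eq: "\<Gamma> = canonical_embedding f"
        using unique f_embed by simp
      obtain V where V: "open V" "W = {g. (\<lambda>\<psi> :: ('z \<Rightarrow>\<^sub>L real) \<Rightarrow>\<^sub>L real. blinfun_apply \<psi> g) \<in> V}"
        using W(1)[unfolded openin_weak_iff] by blast
      have W_eq: "W = {g. blinfun_apply (canonical_embedding g) \<in> V}"
        unfolding V(2) canonical_embedding_def blinfun.prod_left.rep_eq ..
      have "openin weak_star_topology {\<Psi>. blinfun_apply \<Psi> \<in> V}"
        using V(1) by (auto simp: openin_weak_star_iff)
      then have "frequently (\<lambda>g. g \<in> W) F"
        using \<Gamma>(2) W(2) unfolding weak_star_cluster_point_def \<Gamma>_eq W_eq by force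
      from frequently_eventually_frequently[OF this ev_outside] show False
        by (auto dest: frequently_ex)
    qed
  qed
  then show ?thesis by blast
qed

section \<open>Increasing functions on an infinite compact space\<close>

lemma compact_Urysohn_point:
  fixes k :: "'k::t2_space"
  assumes "compact (UNIV :: 'k set)" "open U" "k \<in> U"
  obtains h :: "'k \<Rightarrow> real" where "continuous_on UNIV h" "\<And>x. 0 \<le> h x" "\<And>x. h x \<le> 1"
    "h k = 1" "\<And>x. x \<notin> U \<Longrightarrow> h x = 0"
proof -
  have H: "Hausdorff_space (euclidean :: 'k topology)"
    unfolding Hausdorff_space_def disjnt_def by (metis hausdorff open_openin)
  have "compact_space (euclidean :: 'k topology)"
    using assms(1) by (simp add: compact_space_def)
  with H have "completely_regular_space (euclidean :: 'k topology)"
    by (intro normal_imp_completely_regular_space compact_Hausdorff_or_regular_imp_normal_space) auto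
  moreover have "closedin euclidean (- U)" "k \<in> topspace euclidean - - U"
    using assms by auto
  ultimately obtain f :: "'k \<Rightarrow> real" where f: "continuous_map euclidean (top_of_set {0..1}) f"
    "f k = 0" "f ` (- U) \<subseteq> {1}"
    unfolding completely_regular_space_def by blast
  show thesis
  proof (rule that[of "\<lambda>x. 1 - f x"])
    have c: "continuous_on UNIV f" and r: "f \<in> UNIV \<rightarrow> {0..1}"
      using f(1) by (auto simp: continuous_map_in_subtopology)
    show "continuous_on UNIV (\<lambda>x. 1 - f x)" by (intro continuous_intros c)
    fix x
    show "0 \<le> 1 - f x" "1 - f x \<le> 1" using r by (auto simp: Pi_iff)
    show "x \<notin> U \<Longrightarrow> 1 - f x = 0" using f(3) by auto
  qed (use f in auto)
qed

text \<open>All functions vanish near one fixed accumulation point \<open>p\<close>. Every neighbourhood \<open>V\<close> of \<open>p\<close> on which the current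
  function vanishes contains a further point \<open>k' \<noteq> p\<close>, and the function can be raised to \<open>1\<close> at \<open>k'\<close> without
  being changed outside \<open>V\<close> or on a smaller neighbourhood of \<open>p\<close>.\<close>
lemma exists_increasing_functions:
  assumes K: "compact (UNIV :: 'k::t2_space set)" "infinite (UNIV :: 'k set)"
  obtains s :: "nat \<Rightarrow> 'k::t2_space \<Rightarrow> real" and k :: "nat \<Rightarrow> 'k"
  where "\<And>n. continuous_on UNIV (s n)" "\<And>n x. 0 \<le> s n x" "\<And>n x. s n x \<le> 1"
    "\<And>m n x. m \<le> n \<Longrightarrow> s m x \<le> s n x"
    "\<And>m n. m < n \<Longrightarrow> s n (k m) = 1" "\<And>m n. n \<le> m \<Longrightarrow> s n (k m) = 0"
proof -
  obtain p :: 'k where p: "p islimpt UNIV"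
    using Heine_Borel_imp_Bolzano_Weierstrass[OF K] by auto
  define P where "P = (\<lambda>(n::nat) (s :: 'k \<Rightarrow> real, V, k :: 'k).
    continuous_on UNIV s \<and> (\<forall>x. 0 \<le> s x \<and> s x \<le> 1) \<and> open V \<and> p \<in> V \<and> (\<forall>x\<in>V. s x = 0))"
  define Q where "Q = (\<lambda>(n::nat) (s :: 'k \<Rightarrow> real, V, k :: 'k) (s', V', k').
    (\<forall>x. s x \<le> s' x) \<and> V' \<subseteq> V \<and> k' \<in> V \<and> s' k' = 1)"
  \<comment> \<open>A state consists of the current function, a neighbourhood of \<open>p\<close> on which it vanishes, and the point
    chosen last; the point of the initial state is arbitrary, and reading off \<open>k n\<close> from state \<open>Suc n\<close>
    discards it.\<close>
  have "\<exists>F. \<forall>n. P n (F n) \<and> Q n (F n) (F (Suc n))"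
  proof (rule dependent_nat_choice)
    show "\<exists>t. P 0 t"
      by (rule exI[of _ "(\<lambda>_. 0, UNIV, p)"]) (auto simp: P_def)
  next
    fix t n assume "P n t"
    moreover obtain s V k where t: "t = (s, V, k)" by (cases t)
    ultimately have s: "continuous_on UNIV s" "\<And>x. 0 \<le> s x" "\<And>x. s x \<le> 1"
      and V: "open V" "p \<in> V" "\<And>x. x \<in> V \<Longrightarrow> s x = 0" by (auto simp: P_def)
    obtain k' where k': "k' \<in> V" "k' \<noteq> p" using p V unfolding islimpt_def by blast
    obtain U W where UW: "open U" "open W" "k' \<in> U" "p \<in> W" "U \<inter> W = {}"
      using hausdorff[OF k'(2)] by blast
    obtain h :: "'k \<Rightarrow> real" where h: "continuous_on UNIV h" "\<And>x. 0 \<le> h x" "\<And>x. h x \<le> 1"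
      "h k' = 1" "\<And>x. x \<notin> U \<inter> V \<Longrightarrow> h x = 0"
      using compact_Urysohn_point[OF K(1), of "U \<inter> V" k'] UW V k' by blast
    have "P (Suc n) (\<lambda>x. max (s x) (h x), V \<inter> W, k')"
      unfolding P_def prod.case
    proof (intro conjI allI ballI)
      show "max (s y) (h y) = 0" if "y \<in> V \<inter> W" for y
      proof -
        from that UW(5) have "y \<notin> U" "y \<in> V" by auto
        then show ?thesis using V(3)[of y] h(5)[of y] by simp
      qed
    qed (use s V UW h in \<open>auto intro!: continuous_intros simp: le_max_iff_disj\<close>)
    moreover have "Q n t (\<lambda>x. max (s x) (h x), V \<inter> W, k')"
      unfolding Q_def t using k' h(4) s(3)[of k'] by auto
    ultimately show "\<exists>t'. P (Suc n) t' \<and> Q n t t'" by blast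
  qed
  then obtain F where F: "\<And>n. P n (F n)" "\<And>n. Q n (F n) (F (Suc n))" by blast
  define s V k where "s n = fst (F n)" and "V n = fst (snd (F n))" and "k n = snd (snd (F (Suc n)))"
    for n
  have s: "continuous_on UNIV (s n)" "0 \<le> s n x" "s n x \<le> 1"
    and sV: "x \<in> V n \<Longrightarrow> s n x = 0" for n x
    using F(1)[of n] by (auto simp: P_def s_def V_def split: prod.splits)
  have step: "s n x \<le> s (Suc n) x" "V (Suc n) \<subseteq> V n" "k n \<in> V n" "s (Suc n) (k n) = 1" for n x
    using F(2)[of n] by (auto simp: Q_def s_def V_def k_def split: prod.splits)
  have mono: "s m x \<le> s n x" if "m \<le> n" for m n x
    using lift_Suc_mono_le[of "\<lambda>n. s n x"] step(1) that by blast
  have anti: "V n \<subseteq> V m" if "m \<le> n" for m n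
    using lift_Suc_antimono_le[of V] step(2) that by blast
  show thesis
  proof (rule that[of s k])
    show "s n (k m) = 1" if "m < n" for m n
      using mono[of "Suc m" n "k m"] step(4)[of m] s(3)[of n "k m"] that by simp
    show "s n (k m) = 0" if "n \<le> m" for m n
      using anti[OF that] step(3)[of m] by (intro sV) blast
  qed (fact s mono)+
qed

section \<open>Operators into a space of continuous functions\<close>

definition bcontfun_mult ::
    "('k::topological_space \<Rightarrow>\<^sub>C real) \<Rightarrow> ('k \<Rightarrow>\<^sub>C real) \<Rightarrow> ('k \<Rightarrow>\<^sub>C real)"
  where "bcontfun_mult s c = Bcontfun (\<lambda>k. s k * c k)"

lemma bcontfun_value_le:
  fixes c :: "'k::topological_space \<Rightarrow>\<^sub>C real"
  shows "\<bar>c k\<bar> \<le> norm c"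
  using norm_bounded[of c k] by simp

lemma bcontfun_mult_apply [simp]: "bcontfun_mult s c k = s k * c k"
proof -
  have "(\<lambda>k. s k * c k) \<in> bcontfun"
    by (rule bcontfun_normI[where b = "norm s * norm c"])
      (auto intro!: continuous_intros mult_mono bcontfun_value_le simp: abs_mult)
  then show ?thesis by (simp add: bcontfun_mult_def Bcontfun_inverse)
qed

lemma bounded_bilinear_bcontfun_mult:
  "bounded_bilinear (bcontfun_mult :: ('k::topological_space \<Rightarrow>\<^sub>C real) \<Rightarrow> _)"
proof
  have "norm (bcontfun_mult a b) \<le> norm a * norm b * 1" for a b :: "'k \<Rightarrow>\<^sub>C real"
    by (rule norm_bound) (auto intro!: mult_mono bcontfun_value_le simp: abs_mult)
  then show "\<exists>K. \<forall>a b :: 'k \<Rightarrow>\<^sub>C real. norm (bcontfun_mult a b) \<le> norm a * norm b * K"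
    by blast
qed (auto intro!: bcontfun_eqI simp: algebra_simps)

text \<open>The \<open>C(K)\<close>-module structure of the space of operators into \<open>C(K)\<close>.\<close>
definition operator_mult :: "('k::topological_space \<Rightarrow>\<^sub>C real) \<Rightarrow>
    ('x::real_normed_vector \<Rightarrow>\<^sub>L ('k \<Rightarrow>\<^sub>C real)) \<Rightarrow> ('x \<Rightarrow>\<^sub>L ('k \<Rightarrow>\<^sub>C real))"
  where "operator_mult s A = Blinfun (bcontfun_mult s) o\<^sub>L A"

lemma operator_mult_apply [simp]: "operator_mult s A x k = s k * A x k"
  by (simp add: operator_mult_def bounded_linear_Blinfun_apply
      bounded_bilinear.bounded_linear_right[OF bounded_bilinear_bcontfun_mult])

lemma operator_value_le:
  fixes A :: "'x::real_normed_vector \<Rightarrow>\<^sub>L ('k::topological_space \<Rightarrow>\<^sub>C real)"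
  shows "\<bar>A x k\<bar> \<le> norm A * norm x"
  using norm_bounded[of "A x" k] norm_blinfun[of A x] by simp

lemma norm_operator_le:
  fixes A :: "'x::real_normed_vector \<Rightarrow>\<^sub>L ('k::topological_space \<Rightarrow>\<^sub>C real)"
  assumes "b \<ge> 0" "\<And>x k. \<bar>A x k\<bar> \<le> b * norm x"
  shows "norm A \<le> b"
  using assms by (intro norm_blinfun_bound norm_bound) auto

text \<open>At each point of \<open>K\<close> the operator is the convex combination of \<open>A\<close> and \<open>B\<close> with weight \<open>s\<close>, and the
  norm of an operator into \<open>C(K)\<close> is the supremum over these points.\<close>
lemma norm_operator_interpolation_le:
  fixes A B :: "'x::real_normed_vector \<Rightarrow>\<^sub>L ('k::topological_space \<Rightarrow>\<^sub>C real)"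
    and s :: "'k \<Rightarrow>\<^sub>C real"
  assumes A: "norm A \<le> 1" and B: "norm B \<le> 1" and s: "\<And>k. 0 \<le> s k" "\<And>k. s k \<le> 1"
  shows "norm (A + operator_mult s (B - A)) \<le> 1"
proof (rule norm_operator_le)
  fix x k
  have "\<bar>A x k\<bar> \<le> norm x" "\<bar>B x k\<bar> \<le> norm x"
    using operator_value_le[of A x k] operator_value_le[of B x k] A B
      mult_right_mono[of _ 1 "norm x"] by fastforce+
  then have "\<bar>(1 - s k) * A x k\<bar> + \<bar>s k * B x k\<bar> \<le> (1 - s k) * norm x + s k * norm x"
    unfolding abs_mult using s by (intro add_mono mult_mono) auto
  moreover have "(A + operator_mult s (B - A)) x k = (1 - s k) * A x k + s k * B x k"
    by (simp add: blinfun.add_left blinfun.diff_left algebra_simps)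
  ultimately show "\<bar>(A + operator_mult s (B - A)) x k\<bar> \<le> 1 * norm x"
    by (simp add: algebra_simps)
qed simp

text \<open>One \<open>x\<close> serves for all \<open>k\<close> and \<open>c\<close>: the values at \<open>x\<close> and \<open>k\<close> of the zero operator and of a
  norming functional followed by the constants are distinct, so one of them differs from \<open>c\<close>.\<close>
lemma exists_operator_value_neq:
  assumes "\<exists>x::'x::real_normed_vector. x \<noteq> 0"
  shows "\<exists>x::'x. \<forall>(k::'k::topological_space) c.
    \<exists>B :: 'x \<Rightarrow>\<^sub>L ('k \<Rightarrow>\<^sub>C real). norm B \<le> 1 \<and> apply_bcontfun (blinfun_apply B x) k \<noteq> c"
proof -
  obtain x :: 'x where "x \<noteq> 0" using assms by blast
  obtain f :: "'x \<Rightarrow>\<^sub>L real" where f: "norm f \<le> 1" "f x = norm x"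
    by (rule exists_norming_functional)
  have bl: "bounded_linear (\<lambda>x. const_bcontfun (f x) :: 'k \<Rightarrow>\<^sub>C real)"
  proof (rule bounded_linear_intro[where K = 1])
    fix y
    show "norm (const_bcontfun (f y) :: 'k \<Rightarrow>\<^sub>C real) \<le> norm y * 1"
      using norm_blinfun[of f y] f(1) mult_right_mono[OF f(1), of "norm y"]
      by (intro norm_bound) (simp add: const_bcontfun.rep_eq)
  qed (auto intro!: bcontfun_eqI simp: const_bcontfun.rep_eq blinfun.add_right blinfun.scaleR_right)
  define B where "B = Blinfun (\<lambda>x. const_bcontfun (f x) :: 'k \<Rightarrow>\<^sub>C real)"
  have B: "B y k = f y" for y k
    by (simp add: B_def bounded_linear_Blinfun_apply[OF bl] const_bcontfun.rep_eq)
  have "norm B \<le> 1"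
  proof (rule norm_operator_le)
    fix y k
    show "\<bar>B y k\<bar> \<le> 1 * norm y"
      using norm_blinfun[of f y] mult_right_mono[OF f(1), of "norm y"] by (simp add: B)
  qed simp
  then have "\<exists>B :: 'x \<Rightarrow>\<^sub>L ('k \<Rightarrow>\<^sub>C real). norm B \<le> 1 \<and> apply_bcontfun (blinfun_apply B x) k \<noteq> c" for k c
    using f(2) \<open>x \<noteq> 0\<close> B[of x k]
    by (cases "c = 0") (auto intro: exI[of _ B] exI[of _ 0])
  then show ?thesis by blast
qed

lemma bounded_linear_operator_value:
  "bounded_linear (\<lambda>A :: 'x::real_normed_vector \<Rightarrow>\<^sub>L ('k::topological_space \<Rightarrow>\<^sub>C real). A x k)"
  by (rule bounded_linear_intro[where K = "norm x"])
    (auto simp: blinfun.add_left blinfun.scaleR_left intro: operator_value_le)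

section \<open>No continuity points in a dual space of operators\<close>

text \<open>Balls of the dual are weak-star closed: the norm bound passes from \<open>b m\<close> to the cluster point.\<close>
lemma norm_cluster_diff_le:
  fixes b :: "nat \<Rightarrow> 'a::real_normed_vector \<Rightarrow>\<^sub>L real"
  assumes cluster: "weak_star_cluster_point a b sequentially"
    and bound: "\<And>m. m \<ge> n \<Longrightarrow> norm (f + (b m - b n)) \<le> C"
  shows "norm (f + a - b n) \<le> C"
proof (rule norm_blinfun_bound)
  show "0 \<le> C" using bound[of n] norm_ge_zero order_trans by blast
  fix z
  have "norm ((f + a - b n) z) \<le> C * norm z + \<epsilon>" if "\<epsilon> > 0" for \<epsilon>
  proof -
    obtain m where m: "m \<ge> n" "\<bar>b m z - a z\<bar> < \<epsilon>"
      using weak_star_cluster_point_evaluation[OF cluster \<open>\<epsilon> > 0\<close>, of z]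
      unfolding frequently_sequentially by blast
    have "norm ((f + (b m - b n)) z) \<le> C * norm z"
      using norm_blinfun[of "f + (b m - b n)" z] mult_right_mono[OF bound[OF m(1)], of "norm z"] by simp
    then show ?thesis
      using m(2) by (simp add: blinfun.add_left blinfun.diff_left)
  qed
  then show "norm ((f + a - b n) z) \<le> C * norm z" by (rule field_le_epsilon)
qed

text \<open>The functionals \<open>b n\<close> correspond to \<open>s n (B - T f)\<close>. A continuity point \<open>f\<close> makes evaluations at points of
  \<open>K\<close> commute with passing to the cluster point \<open>a\<close>, but the pointwise limit of \<open>s n\<close> is discontinuous at \<open>l\<close>, where \<open>B\<close> and
  \<open>T f\<close> differ.\<close>
theorem no_weak_star_weak_continuity_point:
  fixes T :: "('z::real_normed_vector \<Rightarrow>\<^sub>L real) \<Rightarrow>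
    ('x::real_normed_vector \<Rightarrow>\<^sub>L ('k::t2_space \<Rightarrow>\<^sub>C real))"
    and f :: "'z \<Rightarrow>\<^sub>L real"
  assumes X: "\<exists>x::'x. x \<noteq> 0"
    and K: "compact (UNIV :: 'k set)" "infinite (UNIV :: 'k set)"
    and T: "isometric_isomorphism T"
  shows "\<not> weak_star_weak_continuity_point f"
proof
  assume f: "weak_star_weak_continuity_point f"
  have lin: "linear T" and iso: "\<And>g :: 'z \<Rightarrow>\<^sub>L real. norm (T g) = norm g" and surj: "surj T"
    using T by (auto simp: isometric_isomorphism_def)
  have blT: "bounded_linear T"
    using lin iso by (intro bounded_linear_intro[where K = 1]) (auto simp: linear_add linear_scale)
  have Tf: "norm (T f) \<le> 1"
    using f by (simp add: iso weak_star_weak_continuity_point_iff)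
  obtain s :: "nat \<Rightarrow> 'k \<Rightarrow> real" and k where
    s: "\<And>n. continuous_on UNIV (s n)" "\<And>n x. 0 \<le> s n x" "\<And>n x. s n x \<le> 1"
      "\<And>m n x. m \<le> n \<Longrightarrow> s m x \<le> s n x"
    and sk: "\<And>m n. m < n \<Longrightarrow> s n (k m) = 1" "\<And>m n. n \<le> m \<Longrightarrow> s n (k m) = 0"
    using exists_increasing_functions[OF K] by blast
  define S where "S n = Bcontfun (s n)" for n
  have "s n \<in> bcontfun" for n
    by (rule bcontfun_normI[where b = 1]) (use s in auto)
  then have S: "S n x = s n x" for n x
    by (simp add: S_def Bcontfun_inverse)
  \<comment> \<open>At \<open>l\<close> all \<open>s n\<close> vanish although their limit at every \<open>k m\<close> is \<open>1\<close>.\<close>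
  obtain l where l: "\<And>U. open U \<Longrightarrow> l \<in> U \<Longrightarrow> frequently (\<lambda>m. k m \<in> U) sequentially"
    using compact_imp_cluster_point[OF K(1), of sequentially k] by auto
  have agree_at_l: "c l = d l" if "eventually (\<lambda>m. c (k m) = d (k m)) sequentially"
    "continuous_on UNIV c" "continuous_on UNIV d" for c d :: "'k \<Rightarrow> real"
  proof (rule ccontr)
    assume "c l \<noteq> d l"
    then have "frequently (\<lambda>m. k m \<in> {x. c x \<noteq> d x}) sequentially"
      using that by (intro l open_Collect_neq) auto
    from frequently_eventually_frequently[OF this that(1)] show False
      by (auto dest: frequently_ex)
  qed
  have s_l: "s n l = 0" for n
    by (rule agree_at_l) (auto intro!: s eventually_sequentiallyI[of n] sk)
  obtain x :: 'x where "\<And>(k::'k) c.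
      \<exists>B :: 'x \<Rightarrow>\<^sub>L ('k \<Rightarrow>\<^sub>C real). norm B \<le> 1 \<and> apply_bcontfun (blinfun_apply B x) k \<noteq> c"
    using exists_operator_value_neq[OF X, where 'k = 'k] by blast
  then obtain B :: "'x \<Rightarrow>\<^sub>L ('k \<Rightarrow>\<^sub>C real)" where B: "norm B \<le> 1" "B x l \<noteq> T f x l" by blast
  define b where "b n = inv T (operator_mult (S n) (B - T f))" for n
  have b: "T (b n) = operator_mult (S n) (B - T f)" for n
    unfolding b_def by (rule surj_f_inv_f[OF surj])
  have segment: "norm (f + g) \<le> 1"
    if "T g = operator_mult r (B - T f)" "\<And>y. 0 \<le> r y" "\<And>y. r y \<le> 1" for g r
  proof -
    have "norm (T f + operator_mult r (B - T f)) \<le> 1"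
      by (rule norm_operator_interpolation_le[OF Tf B(1) that(2,3)])
    then show ?thesis using that(1) by (metis iso linear_add[OF lin])
  qed
  have segment_diff: "norm (f + (b m - b n)) \<le> 1" if "m \<ge> n" for m n
  proof (rule segment)
    show "T (b m - b n) = operator_mult (S m - S n) (B - T f)"
      unfolding linear_diff[OF lin] b
      by (intro blinfun_eqI bcontfun_eqI) (simp add: blinfun.diff_left left_diff_distrib)
    show "0 \<le> (S m - S n) y" for y using s(4)[OF that, of y] by (simp add: S)
    show "(S m - S n) y \<le> 1" for y using s(2)[of n y] s(3)[of m y] by (simp add: S)
  qed
  have "norm (b n) \<le> 2" for n
  proof -
    have "norm (f + b n) \<le> 1" by (rule segment[OF b]) (simp_all add: S s)
    moreover have "norm (b n) \<le> norm (f + b n) + norm f"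
      using norm_triangle_ineq4[of "f + b n" f] by simp
    ultimately show ?thesis using Tf by (simp add: iso)
  qed
  then obtain a where a: "weak_star_cluster_point a b sequentially"
    using bounded_imp_weak_star_cluster_point[of sequentially b 2] by auto
  have ball: "norm (f + a - b n) \<le> 1" for n
    by (rule norm_cluster_diff_le[OF a segment_diff])
  have value_eq: "T a x y = c" if "eventually (\<lambda>n. T (b n) x y = c) sequentially" for y c
  proof -
    have "bounded_linear (\<lambda>g. T g x y)"
      by (rule bounded_linear_compose[OF bounded_linear_operator_value blT])
    then have "blinfun_apply (Blinfun (\<lambda>g. T g x y)) = (\<lambda>g. T g x y)"
      by (rule bounded_linear_Blinfun_apply)
    with continuity_point_cluster_eq[OF f a ball, of "Blinfun (\<lambda>g. T g x y)" c] that
    show ?thesis by simp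
  qed
  have "T a x (k m) = (B - T f) x (k m)" for m
    by (rule value_eq) (auto intro!: eventually_sequentiallyI[of "Suc m"] simp: b S sk)
  then have "T a x l = (B - T f) x l"
    by (intro agree_at_l) auto
  moreover have "T a x l = 0"
    by (rule value_eq) (simp add: b S s_l)
  ultimately show False
    using B(2) by (simp add: blinfun.diff_left)
qed

theorem proposition28:
  fixes T :: "('z::banach \<Rightarrow>\<^sub>L real) \<Rightarrow> ('x::banach \<Rightarrow>\<^sub>L ('k::t2_space \<Rightarrow>\<^sub>C real))"
  assumes "\<exists>x::'x. x \<noteq> 0"
    and "reflexive_space TYPE('x)"
    and "compact (UNIV :: 'k set)"
    and "infinite (UNIV :: 'k set)"
    and "isometric_isomorphism T"
  shows "\<not> (\<exists>f :: 'z \<Rightarrow>\<^sub>L real. weak_star_weak_continuity_point f) \<and>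
    \<not> (\<exists>z :: 'z. very_smooth_point z)"
  using no_weak_star_weak_continuity_point[OF assms(1,3,4,5)]
    very_smooth_point_imp_continuity_point by blast

end
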